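(* Consider a ten-qubit system with Hamiltonian $H=\sum_{l=1}^{10}\tilde H_l$, where $H_l=\sum_{i=0}^1(E_l+i\alpha_l)|i\rangle\langle i|$ with $E_l\in\mathbb{R}$. Suppose that exactly one of the qubits (the central qubit) has energy gap $\alpha_l=\alpha_c$ and the nine remaining qubits have energy gap $\alpha_l=\alpha$, where $\alpha>\alpha_c\ge 0$. Let $\rho$ be a ten-qubit state that is separable across the $1$-vs-$1^c$ bipartition, where $1^c=\{2,\dots,10\}$, and let $\Delta_{1|1^c}=W(\rho)-W_{[1]}(\rho_1)-E(\rho_{1^c})+E_g^{1^c}$. Then: (a) if qubit $1$ is the central qubit, i.e. $\alpha_1=\alpha_c<\alpha_j=\alpha$ for all $j\ne1$, then $\Delta_{1|1^c}\le 0$; (b) if $\alpha_1=\alpha$ (so that the central qubit is one of the qubits in $1^c$), then $\Delta_{1|1^c}\le\dfrac{\alpha-\alpha_c}{2}$.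
   Context: $\tilde H_l$ denotes $H_l$ acting on the $l$-th qubit tensored with identities on all the other qubits. A state is a positive semidefinite trace-one operator; $\rho_1$ and $\rho_{1^c}$ are the reduced states of $\rho$ on qubit 1 and on qubits $2,\dots,10$. $\rho$ is separable across $1$-vs-$1^c$ if it is a convex combination of product states $\sigma_1\otimes\tau_{1^c}$. The energy of a state $\sigma$ of a (sub)system with Hamiltonian $K$ is $E(\sigma)=\mathrm{Tr}[\sigma K]$. The ergotropy of $\sigma$ with respect to $K$ is $\mathrm{Tr}[\sigma K]-\min_U\mathrm{Tr}[U\sigma U^\dagger K]$, the minimum being over all unitaries $U$ on the corresponding Hilbert space. $W(\rho)$ is the ergotropy of $\rho$ with respect to $H$, $W_{[1]}(\rho_1)$ is the ergotropy of $\rho_1$ with respect to $H_1$, $E(\rho_{1^c})$ is the energy of $\rho_{1^c}$ with respect to the sum $H_{1^c}$ of the local Hamiltonians of qubits $2,\dots,10$, and $E_g^{1^c}=\sum_{l=2}^{10}E_l$ is the ground-state energy of $H_{1^c}$. *)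

theory Defs
  imports "HOL-Analysis.Analysis"
begin

text \<open>Operators on the Hilbert space with orthonormal basis indexed by \<open>'n\<close>.\<close>

type_synonym 'n op = "complex ^ 'n ^ 'n"

definition dagger :: "'n::finite op \<Rightarrow> 'n op" where
  "dagger A = (\<chi> i j. cnj (A $ j $ i))"

definition unitary :: "'n::finite op \<Rightarrow> bool" where
  "unitary U \<longleftrightarrow> dagger U ** U = mat 1 \<and> U ** dagger U = mat 1"

definition braket :: "complex ^ 'n \<Rightarrow> complex ^ 'n \<Rightarrow> complex" where
  "braket v w = (\<Sum>i\<in>UNIV. cnj (v $ i) * w $ i)"

definition positive_semidefinite :: "'n::finite op \<Rightarrow> bool" where
  "positive_semidefinite A \<longleftrightarrow> dagger A = A \<and> (\<forall>v. 0 \<le> Re (braket v (A *v v)))"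

definition state :: "'n::finite op \<Rightarrow> bool" where
  "state \<rho> \<longleftrightarrow> positive_semidefinite \<rho> \<and> trace \<rho> = 1"

text \<open>The trace below is real whenever \<open>\<sigma>\<close> and \<open>K\<close> are Hermitian, so taking
  the real part only changes the type.\<close>

definition energy :: "'n::finite op \<Rightarrow> 'n op \<Rightarrow> real" where
  "energy \<sigma> K = Re (trace (\<sigma> ** K))"

definition ergotropy :: "'n::finite op \<Rightarrow> 'n op \<Rightarrow> real" where
  "ergotropy \<sigma> K = energy \<sigma> K
     - (LEAST e. \<exists>U. unitary U \<and> e = energy (U ** \<sigma> ** dagger U) K)"

lemma continuous_on_dagger [continuous_intros]:
  "continuous_on S f \<Longrightarrow> continuous_on S (\<lambda>x. dagger (f x))"
  unfolding dagger_def by (intro continuous_intros)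

lemma continuous_on_matrix_mult [continuous_intros]:
  fixes f :: "'a::topological_space \<Rightarrow> complex ^ 'n::finite ^ 'm::finite" and g :: "'a \<Rightarrow> complex ^ 'k::finite ^ 'n"
  assumes "continuous_on S f" "continuous_on S g"
  shows "continuous_on S (\<lambda>x. f x ** g x)"
  unfolding matrix_matrix_mult_def using assms by (intro continuous_intros)

lemma unitary_entry_le_1:
  fixes U :: "'n::finite op"
  assumes "unitary U" shows "norm (U $ i $ j) \<le> 1"
proof -
  have "(U ** dagger U) $ i $ i = 1"
    using assms by (simp add: unitary_def mat_def)
  moreover have "(U ** dagger U) $ i $ i = of_real (\<Sum>k\<in>UNIV. (norm (U $ i $ k))\<^sup>2)"
    by (simp add: matrix_matrix_mult_def dagger_def complex_norm_square del: of_real_power)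
  ultimately have *: "(\<Sum>k\<in>UNIV. (norm (U $ i $ k))\<^sup>2) = 1"
    by (metis of_real_eq_1_iff)
  have "(norm (U $ i $ j))\<^sup>2 \<le> (\<Sum>k\<in>UNIV. (norm (U $ i $ k))\<^sup>2)"
    by (rule member_le_sum) auto
  then show ?thesis
    using * by (simp add: abs_square_le_1)
qed

lemma compact_unitary: "compact {U :: 'n::finite op. unitary U}"
proof (subst compact_eq_bounded_closed, intro conjI)
  have "norm U \<le> (\<Sum>i\<in>(UNIV::'n set). \<Sum>j\<in>(UNIV::'n set). 1)" if "unitary U" for U :: "'n op"
  proof -
    have "norm U \<le> (\<Sum>i\<in>UNIV. norm (U $ i))"
      by (simp add: norm_vec_def L2_set_le_sum)
    also have "\<dots> \<le> (\<Sum>i\<in>UNIV. \<Sum>j\<in>UNIV. norm (U $ i $ j))"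
      by (intro sum_mono) (simp add: norm_vec_def L2_set_le_sum)
    also have "\<dots> \<le> (\<Sum>i\<in>(UNIV::'n set). \<Sum>j\<in>(UNIV::'n set). 1)"
      by (intro sum_mono unitary_entry_le_1 that)
    finally show ?thesis .
  qed
  then show "bounded {U :: 'n op. unitary U}"
    unfolding bounded_iff by blast
  have "closed ({U :: 'n op. dagger U ** U = mat 1} \<inter> {U. U ** dagger U = mat 1})"
    by (intro closed_Int closed_Collect_eq continuous_intros)
  then show "closed {U :: 'n op. unitary U}"
    by (simp add: unitary_def Collect_conj_eq)
qed

text \<open>The minimum in \<open>ergotropy\<close> is attained, so that \<open>LEAST\<close> is well defined.\<close>

lemma ergotropy_minimum_attained:
  fixes \<sigma> K :: "'n::finite op"
  shows "\<exists>U. unitary U \<and> (\<forall>V. unitary V \<longrightarrow>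
           energy (U ** \<sigma> ** dagger U) K \<le> energy (V ** \<sigma> ** dagger V) K)"
proof -
  have "unitary (mat 1 :: 'n op)"
  proof -
    have "dagger (mat 1) = (mat 1 :: 'n op)"
      by (auto simp: dagger_def mat_def vec_eq_iff)
    then show ?thesis by (simp add: unitary_def)
  qed
  moreover have "continuous_on {U :: 'n op. unitary U} (\<lambda>U. energy (U ** \<sigma> ** dagger U) K)"
    unfolding energy_def trace_def by (intro continuous_intros)
  ultimately show ?thesis
    using continuous_attains_inf [OF compact_unitary] by blast
qed

text \<open>A register with qubits labelled by \<open>'q\<close> has the computational basis \<open>'q \<Rightarrow> bool\<close>;
  a single qubit has the
  basis \<open>bool\<close>, where \<open>False\<close> is the ket 0 and \<open>True\<close> is the ket 1.\<close>

definition qubit_hamiltonian :: "real \<Rightarrow> real \<Rightarrow> bool op" where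
  "qubit_hamiltonian e a = (\<chi> i j. if i = j then of_real (e + of_bool i * a) else 0)"

text \<open>The operator \<open>A\<close> on qubit \<open>l\<close>, tensored with the identity on all other qubits.\<close>

definition on_qubit :: "'q \<Rightarrow> bool op \<Rightarrow> ('q::finite \<Rightarrow> bool) op" where
  "on_qubit l A = (\<chi> x y. if \<forall>k. k \<noteq> l \<longrightarrow> x k = y k then A $ x l $ y l else 0)"

definition hamiltonian :: "('q \<Rightarrow> real) \<Rightarrow> ('q \<Rightarrow> real) \<Rightarrow> ('q::finite \<Rightarrow> bool) op" where
  "hamiltonian E \<alpha> = (\<Sum>l\<in>UNIV. on_qubit l (qubit_hamiltonian (E l) (\<alpha> l)))"

typedef qubit = "{1..10::nat}" morphisms label qubit by auto

typedef rest_qubit = "{2..10::nat}" morphisms rest_label rest_qubit by auto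

instance qubit :: finite
  by standard (simp add: type_definition.univ [OF type_definition_qubit])

instance rest_qubit :: finite
  by standard (simp add: type_definition.univ [OF type_definition_rest_qubit])

abbreviation first :: qubit where "first \<equiv> qubit 1"

text \<open>Basis states of the ten-qubit register correspond to pairs of a basis state of qubit 1 and
  one of qubits 2 to 10: \<open>x\<close> is \<open>join (x first) (restrict_rest x)\<close>.\<close>

definition restrict_rest :: "(qubit \<Rightarrow> bool) \<Rightarrow> (rest_qubit \<Rightarrow> bool)" where
  "restrict_rest x = (\<lambda>k. x (qubit (rest_label k)))"

definition join :: "bool \<Rightarrow> (rest_qubit \<Rightarrow> bool) \<Rightarrow> (qubit \<Rightarrow> bool)" where
  "join b z = (\<lambda>l. if l = first then b else z (rest_qubit (label l)))"

text \<open>The product \<open>\<sigma> \<otimes> \<tau>\<close> of an operator on qubit 1 and one on the rest.\<close>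

definition product_op :: "bool op \<Rightarrow> (rest_qubit \<Rightarrow> bool) op \<Rightarrow> (qubit \<Rightarrow> bool) op" where
  "product_op \<sigma> \<tau> =
     (\<chi> x y. \<sigma> $ x first $ y first * \<tau> $ restrict_rest x $ restrict_rest y)"

definition reduced_first :: "(qubit \<Rightarrow> bool) op \<Rightarrow> bool op" where
  "reduced_first \<rho> = (\<chi> i j. \<Sum>z\<in>UNIV. \<rho> $ join i z $ join j z)"

definition reduced_rest :: "(qubit \<Rightarrow> bool) op \<Rightarrow> (rest_qubit \<Rightarrow> bool) op" where
  "reduced_rest \<rho> = (\<chi> z w. \<Sum>i\<in>UNIV. \<rho> $ join i z $ join i w)"

definition separable_first :: "(qubit \<Rightarrow> bool) op \<Rightarrow> bool" where
  "separable_first \<rho> \<longleftrightarrow>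
     \<rho> \<in> convex hull {product_op \<sigma> \<tau> | \<sigma> \<tau>. state \<sigma> \<and> state \<tau>}"

definition total_hamiltonian :: "(nat \<Rightarrow> real) \<Rightarrow> (nat \<Rightarrow> real) \<Rightarrow> (qubit \<Rightarrow> bool) op" where
  "total_hamiltonian E \<alpha> = hamiltonian (\<lambda>l. E (label l)) (\<lambda>l. \<alpha> (label l))"

definition rest_hamiltonian :: "(nat \<Rightarrow> real) \<Rightarrow> (nat \<Rightarrow> real) \<Rightarrow> (rest_qubit \<Rightarrow> bool) op" where
  "rest_hamiltonian E \<alpha> = hamiltonian (\<lambda>k. E (rest_label k)) (\<lambda>k. \<alpha> (rest_label k))"

text \<open>The last summand is the ground-state energy of \<open>rest_hamiltonian E \<alpha>\<close> when all gaps are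
  nonnegative.\<close>

definition Delta_first :: "(nat \<Rightarrow> real) \<Rightarrow> (nat \<Rightarrow> real) \<Rightarrow> (qubit \<Rightarrow> bool) op \<Rightarrow> real" where
  "Delta_first E \<alpha> \<rho> =
     ergotropy \<rho> (total_hamiltonian E \<alpha>)
     - ergotropy (reduced_first \<rho>) (qubit_hamiltonian (E 1) (\<alpha> 1))
     - energy (reduced_rest \<rho>) (rest_hamiltonian E \<alpha>)
     + (\<Sum>l=2..10. E l)"

end

theory Submission
  imports Defs
begin

text \<open>
  Up to the ground-state energies, \<open>\<Delta>\<close> is the passive energy of \<open>\<rho>\<^sub>1\<close> minus that of \<open>\<rho>\<close>.
  If \<open>\<mu>\<close> is the largest eigenvalue of \<open>\<rho>\<^sub>1\<close>, the former is \<open>\<alpha>\<^sub>1 (1 - \<mu>)\<close>, and separability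
  gives \<open>\<rho> \<le> \<rho>\<^sub>1 \<otimes> 1 \<le> \<mu>\<close>. So in any rotated state \<open>U \<rho> U\<^sup>\<dagger>\<close> every level has population at
  most \<open>\<mu>\<close>. The levels above the ground level cost at least \<open>\<alpha>\<^sub>c\<close>, which gives (a). In (b) all
  but one of them cost at least \<open>\<alpha> = \<alpha>\<^sub>1\<close>. If the exceptional level has population \<open>p \<le> 1/2\<close>, the
  defect is at most \<open>p (\<alpha> - \<alpha>\<^sub>c)\<close>. If \<open>p > 1/2\<close>, then \<open>\<mu> \<ge> p\<close> and the ground level has
  population at most \<open>1 - p\<close>, which again suffices.
\<close>

subsection \<open>Positive semidefinite operators\<close>

lemma braket_add_left: "braket (u + v) w = braket u w + braket v w"
  by (simp add: braket_def algebra_simps sum.distrib)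

lemma braket_add_right: "braket w (u + v) = braket w u + braket w v"
  by (simp add: braket_def algebra_simps sum.distrib)

lemma braket_diff_right: "braket w (u - v) = braket w u - braket w v"
  by (simp add: braket_def algebra_simps sum_subtractf)

lemma braket_scale_left: "braket (a *s v) w = cnj a * braket v w"
  by (simp add: braket_def sum_distrib_left algebra_simps)

lemma braket_scale_right: "braket v (a *s w) = a * braket v w"
  by (simp add: braket_def sum_distrib_left algebra_simps)

lemmas braket_simps =
  braket_add_left braket_add_right braket_scale_left braket_scale_right

lemma braket_self: "braket v v = of_real (\<Sum>i\<in>UNIV. (norm (v $ i))\<^sup>2)"
  by (simp add: braket_def complex_norm_square mult.commute del: of_real_power)

lemma braket_matrix:
  "braket v (M *v w) = (\<Sum>i\<in>UNIV. \<Sum>j\<in>UNIV. cnj (v $ i) * M $ i $ j * w $ j)"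
  by (simp add: braket_def matrix_vector_mult_def sum_distrib_left algebra_simps)

lemma dagger_nth: "dagger A $ i $ j = cnj (A $ j $ i)"
  by (simp add: dagger_def)

lemma braket_hermitian:
  assumes "dagger M = M"
  shows "braket v (M *v w) = cnj (braket w (M *v v))"
proof -
  have M: "M $ i $ j = cnj (M $ j $ i)" for i j
    by (metis assms dagger_nth)
  have "braket v (M *v w) = (\<Sum>j\<in>UNIV. \<Sum>i\<in>UNIV. cnj (v $ i) * M $ i $ j * w $ j)"
    unfolding braket_matrix by (rule sum.swap)
  also have "\<dots> = cnj (braket w (M *v v))"
    unfolding braket_matrix by (subst M) (simp add: algebra_simps)
  finally show ?thesis .
qed

lemma braket_axis: "braket (axis i 1) (M *v axis j 1) = M $ i $ j"
proof -
  have "braket (axis i 1) (M *v axis j 1)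
      = (\<Sum>k\<in>UNIV. \<Sum>l\<in>UNIV. if k = i then (if l = j then M $ k $ l else 0) else 0)"
    unfolding braket_matrix axis_def by (intro sum.cong) auto
  also have "\<dots> = (\<Sum>k\<in>UNIV. if k = i then M $ k $ j else 0)"
    by (intro sum.cong) auto
  finally show ?thesis by simp
qed

text \<open>For Hermitian \<open>M\<close> the two cross terms are complex conjugates of each other,
  so together they give twice a real part.\<close>

lemma quadratic_form_combination:
  fixes M :: "'n::finite op"
  assumes "dagger M = M"
  shows "Re (braket (a *s v + b *s w) (M *v (a *s v + b *s w)))
       = (norm a)\<^sup>2 * Re (braket v (M *v v)) + (norm b)\<^sup>2 * Re (braket w (M *v w))
         + 2 * Re (cnj a * b * braket v (M *v w))"
proof -
  have 1: "Re (cnj b * a * braket w (M *v v)) = Re (cnj a * b * braket v (M *v w))"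
    using braket_hermitian [OF assms, of w v] by (simp add: algebra_simps)
  have 2: "c * (cnj c * z) = of_real ((norm c)\<^sup>2) * z" for c z
    by (simp add: complex_norm_square del: of_real_power)
  have "braket (a *s v + b *s w) (M *v (a *s v + b *s w))
      = of_real ((norm a)\<^sup>2) * braket v (M *v v) + of_real ((norm b)\<^sup>2) * braket w (M *v w)
         + cnj a * b * braket v (M *v w) + cnj b * a * braket w (M *v v)"
    by (simp add: matrix_vector_right_distrib vector_scalar_commute braket_simps
        distrib_left 2 del: of_real_power)
  then show ?thesis
    using 1 by (simp del: of_real_power)
qed

lemma positive_semidefinite_Cauchy_Schwarz:
  assumes "positive_semidefinite M"
  shows "(norm (braket v (M *v w)))\<^sup>2 \<le> Re (braket v (M *v v)) * Re (braket w (M *v w))"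
proof -
  define a d b where "a = Re (braket v (M *v v))" and "d = Re (braket w (M *v w))"
    and "b = braket v (M *v w)"
  have M: "dagger M = M" and pos: "\<And>v. 0 \<le> Re (braket v (M *v v))"
    using assms by (auto simp: positive_semidefinite_def)
  have "a \<ge> 0" "d \<ge> 0"
    using pos by (auto simp: a_def d_def)
  have b: "cnj b * b = of_real ((norm b)\<^sup>2)"
    by (simp add: complex_norm_square mult.commute del: of_real_power)
  \<comment> \<open>This is the quadratic form at \<open>b *s v - t *s w\<close>. The coefficient
    \<open>b\<close> makes the cross term real, equal to
    \<open>- t * (norm b)\<^sup>2\<close>.\<close>
  have *: "0 \<le> (norm b)\<^sup>2 * a + t\<^sup>2 * d - 2 * t * (norm b)\<^sup>2" for t :: real
  proof -
    have "cnj b * of_real (- t) * b = of_real (- t * (norm b)\<^sup>2)"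
      using b by (metis (no_types, lifting) mult.assoc mult.commute of_real_mult)
    then have "Re (cnj b * of_real (- t) * b) = - t * (norm b)\<^sup>2"
      by (metis Re_complex_of_real)
    then show ?thesis
      using pos [of "b *s v + of_real (- t) *s w"]
      unfolding quadratic_form_combination [OF M] a_def [symmetric] d_def [symmetric]
        b_def [symmetric] by simp
  qed
  have "(norm b)\<^sup>2 \<le> a * d"
  proof (cases "d = 0")
    case True
    \<comment> \<open>With \<open>d = 0\<close> the bound is affine in \<open>t\<close>; at
      \<open>t = a + 1\<close> it already forces \<open>b = 0\<close>.\<close>
    have "0 \<le> (norm b)\<^sup>2 * a - 2 * (a + 1) * (norm b)\<^sup>2"
      using * [of "a + 1"] True by simp
    then have "(norm b)\<^sup>2 * (a + 2) \<le> 0" by (simp add: algebra_simps)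
    then have "(norm b)\<^sup>2 \<le> 0"
      using \<open>a \<ge> 0\<close> by (simp add: mult_le_0_iff)
    then show ?thesis using True by simp
  next
    case False
    then have "d > 0" using \<open>d \<ge> 0\<close> by simp
    define s where "s = (norm b)\<^sup>2"
    \<comment> \<open>\<open>t = s / d\<close> minimises the quadratic polynomial in
      \<open>t\<close>.\<close>
    have "0 \<le> s * a + (s / d)\<^sup>2 * d - 2 * (s / d) * s"
      using * [of "s / d"] by (simp add: s_def)
    also have "\<dots> = s * (a - s / d)"
      using \<open>d > 0\<close> by (simp add: field_simps power2_eq_square)
    finally have "s = 0 \<or> s / d \<le> a"
      by (smt (verit) s_def zero_le_power2 zero_le_mult_iff)
    then show ?thesis
      using \<open>d > 0\<close> \<open>a \<ge> 0\<close> by (auto simp: s_def pos_divide_le_eq)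
  qed
  then show ?thesis by (simp add: a_def b_def d_def)
qed

text \<open>A Lagrange-type identity replaces the eigenvalues: summing the form of \<open>M\<close>
  over the antisymmetric combinations \<open>?u i j\<close> of basis vectors gives twice the right
  side minus twice the left side, and every summand is nonnegative.\<close>

lemma positive_semidefinite_le_trace:
  fixes M :: "'n::finite op"
  assumes "positive_semidefinite M"
  shows "Re (braket v (M *v v)) \<le> (\<Sum>i\<in>UNIV. (norm (v $ i))\<^sup>2) * Re (trace M)"
proof -
  have M: "dagger M = M" and pos: "\<And>v. 0 \<le> Re (braket v (M *v v))"
    using assms by (auto simp: positive_semidefinite_def)
  let ?u = "\<lambda>i j. cnj (v $ i) *s axis j 1 + (- cnj (v $ j)) *s axis i 1"
  have u: "Re (braket (?u i j) (M *v ?u i j)) =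
      (norm (v $ i))\<^sup>2 * Re (M $ j $ j) + (norm (v $ j))\<^sup>2 * Re (M $ i $ i)
      - 2 * Re (cnj (v $ j) * M $ j $ i * v $ i)" for i j
    unfolding quadratic_form_combination [OF M] braket_axis by (simp add: algebra_simps)
  have "0 \<le> (\<Sum>i\<in>UNIV. \<Sum>j\<in>UNIV. Re (braket (?u i j) (M *v ?u i j)))"
    by (intro sum_nonneg pos)
  also have "\<dots> = (\<Sum>i\<in>UNIV. \<Sum>j\<in>UNIV. (norm (v $ i))\<^sup>2 * Re (M $ j $ j))
      + (\<Sum>i\<in>UNIV. \<Sum>j\<in>UNIV. (norm (v $ j))\<^sup>2 * Re (M $ i $ i))
      - 2 * (\<Sum>i\<in>UNIV. \<Sum>j\<in>UNIV. Re (cnj (v $ j) * M $ j $ i * v $ i))"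
    unfolding u by (simp only: sum.distrib sum_subtractf sum_distrib_left)
  also have "(\<Sum>i\<in>UNIV. \<Sum>j\<in>UNIV. (norm (v $ j))\<^sup>2 * Re (M $ i $ i))
      = (\<Sum>i\<in>UNIV. \<Sum>j\<in>UNIV. (norm (v $ i))\<^sup>2 * Re (M $ j $ j))"
    by (rule sum.swap)
  also have "(\<Sum>i\<in>UNIV. \<Sum>j\<in>UNIV. (norm (v $ i))\<^sup>2 * Re (M $ j $ j))
      = (\<Sum>i\<in>UNIV. (norm (v $ i))\<^sup>2) * Re (trace M)"
    by (simp add: trace_def sum_product)
  also have "(\<Sum>i\<in>UNIV. \<Sum>j\<in>UNIV. Re (cnj (v $ j) * M $ j $ i * v $ i)) = Re (braket v (M *v v))"
    unfolding braket_matrix by (subst sum.swap) (simp only: Re_sum)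
  finally show ?thesis by (simp add: mult.commute)
qed

lemma state_complement_positive_semidefinite:
  assumes "state \<tau>"
  shows "positive_semidefinite (mat 1 - \<tau>)"
  unfolding positive_semidefinite_def
proof (intro conjI allI)
  have \<tau>: "positive_semidefinite \<tau>" "trace \<tau> = 1"
    using assms by (auto simp: state_def)
  then have "cnj (\<tau> $ j $ i) = \<tau> $ i $ j" for i j
    by (metis dagger_nth positive_semidefinite_def)
  then show "dagger (mat 1 - \<tau>) = mat 1 - \<tau>"
    by (auto simp: vec_eq_iff dagger_nth mat_def)
  fix v
  show "0 \<le> Re (braket v ((mat 1 - \<tau>) *v v))"
    using positive_semidefinite_le_trace [OF \<tau>(1), of v] \<tau>(2)
    by (simp add: matrix_vector_mult_diff_rdistrib braket_diff_right braket_self)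
qed

text \<open>This says that \<open>\<sigma> \<otimes> M\<close> is positive semidefinite. Since \<open>\<sigma>\<close> has size two, the
  Cauchy-Schwarz inequality can replace a spectral decomposition.\<close>

lemma tensor_bool_nonneg:
  fixes \<sigma> :: "bool op" and M :: "'n::finite op"
  assumes \<sigma>: "positive_semidefinite \<sigma>" and M: "positive_semidefinite M"
  shows "0 \<le> Re (\<Sum>a\<in>UNIV. \<Sum>b\<in>UNIV. \<sigma> $ a $ b * braket (w a) (M *v w b))"
proof -
  define G where "G a b = braket (w a) (M *v w b)" for a b
  have \<sigma>_real: "\<sigma> $ a $ b = cnj (\<sigma> $ b $ a)" for a b
    using \<sigma> by (metis dagger_nth positive_semidefinite_def)
  have G_real: "G a b = cnj (G b a)" for a b
    using M braket_hermitian unfolding G_def positive_semidefinite_def by blast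
  have \<sigma>_pos: "0 \<le> Re (\<sigma> $ a $ a)" for a
    using \<sigma> braket_axis unfolding positive_semidefinite_def by metis
  have G_pos: "0 \<le> Re (G a a)" for a
    using M unfolding positive_semidefinite_def G_def by blast
  have im: "Im (\<sigma> $ a $ a) = 0" for a
    using \<sigma>_real [of a a] by (metis complex_cnj_cancel_iff cnj.simps(2) neg_equal_zero)
  define p q where "p = Re (\<sigma> $ False $ False) * Re (G False False)"
    and "q = Re (\<sigma> $ True $ True) * Re (G True True)"
  define z where "z = \<sigma> $ False $ True * G False True"
  \<comment> \<open>Off-diagonal entries of both positive matrices are bounded by their diagonal
    ones. The product of the two bounds, followed by the inequality between geometric and arithmetic
    mean, lets the diagonal terms \<open>p + q\<close> absorb the cross terms
    \<open>2 * Re z\<close>.\<close>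
  have "(norm z)\<^sup>2 \<le> (Re (\<sigma> $ False $ False) * Re (\<sigma> $ True $ True))
      * (Re (G False False) * Re (G True True))"
    unfolding z_def norm_mult power_mult_distrib
    using positive_semidefinite_Cauchy_Schwarz [OF \<sigma>, of "axis False 1" "axis True 1"]
      positive_semidefinite_Cauchy_Schwarz [OF M, of "w False" "w True"] \<sigma>_pos G_pos
    by (intro mult_mono) (auto simp: braket_axis G_def)
  then have "(norm z)\<^sup>2 \<le> p * q"
    by (simp add: p_def q_def algebra_simps)
  also have "p * q \<le> ((p + q) / 2)\<^sup>2"
    using zero_le_power2 [of "p - q"] by (simp add: field_simps power2_eq_square)
  finally have "norm z \<le> (p + q) / 2"
    by (rule power2_le_imp_le) (simp add: p_def q_def \<sigma>_pos G_pos)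
  moreover have "- norm z \<le> Re z"
    using abs_Re_le_cmod [of z] by linarith
  ultimately have "0 \<le> p + q + 2 * Re z"
    by simp
  moreover have "Re (\<sigma> $ True $ False * G True False) = Re z"
    using \<sigma>_real [of True False] G_real [of True False] by (simp add: z_def)
  then have "Re (\<Sum>a\<in>UNIV. \<Sum>b\<in>UNIV. \<sigma> $ a $ b * G a b) = p + q + 2 * Re z"
    by (simp add: UNIV_bool p_def q_def z_def im)
  ultimately show ?thesis
    unfolding G_def by (simp only:)
qed

subsection \<open>The bipartition into qubit 1 and the rest\<close>

lemma rest_label_bounds: "2 \<le> rest_label k" "rest_label k \<le> 10"
  using rest_label [of k] by auto

lemma join_first: "join b z first = b"
  by (simp add: join_def)

lemma restrict_rest_join: "restrict_rest (join b z) = z"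
proof
  fix k
  have "label (qubit (rest_label k)) = rest_label k"
    using rest_label_bounds [of k] by (intro qubit_inverse) auto
  moreover have "label first = 1"
    by (intro qubit_inverse) auto
  ultimately have "qubit (rest_label k) \<noteq> first"
    using rest_label_bounds [of k] by auto
  then show "restrict_rest (join b z) k = z k"
    using \<open>label (qubit (rest_label k)) = rest_label k\<close>
    by (simp add: restrict_rest_def join_def rest_label_inverse)
qed

lemma join_restrict_rest: "join (x first) (restrict_rest x) = x"
proof
  fix l
  show "join (x first) (restrict_rest x) l = x l"
  proof (cases "l = first")
    case False
    then have "label l \<noteq> 1"
      by (metis label_inverse)
    then have "rest_label (rest_qubit (label l)) = label l"
      using label [of l] by (intro rest_qubit_inverse) auto
    then show ?thesis
      using False by (simp add: join_def restrict_rest_def label_inverse)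
  qed (simp add: join_def)
qed

lemma sum_join: "(\<Sum>x\<in>UNIV. f x) = (\<Sum>b\<in>UNIV. \<Sum>z\<in>UNIV. f (join b z))"
proof -
  have "(\<Sum>x\<in>UNIV. f x) = (\<Sum>(b, z)\<in>UNIV. f (join b z))"
    by (rule sum.reindex_bij_witness
        [where j = "\<lambda>x. (x first, restrict_rest x)" and i = "\<lambda>(b, z). join b z"])
      (auto simp: join_first restrict_rest_join join_restrict_rest simp del: One_nat_def)
  then show ?thesis
    by (simp add: sum.cartesian_product)
qed

lemma trace_reduced_first: "trace (reduced_first \<rho>) = trace \<rho>"
  by (simp add: trace_def reduced_first_def sum_join)

lemma reduced_first_product: "trace \<tau> = 1 \<Longrightarrow> reduced_first (product_op \<sigma> \<tau>) = \<sigma>"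
  by (simp add: vec_eq_iff reduced_first_def product_op_def join_first restrict_rest_join
      trace_def del: One_nat_def flip: sum_distrib_left)

text \<open>The right side is the form of \<sigma> tensored with the identity, so the difference of
  the two sides is the form of \<sigma> tensored with \<open>mat 1 - \<tau>\<close>. Both of these
  factors are positive semidefinite.\<close>

lemma product_reduction_criterion:
  assumes "state \<sigma>" "state \<tau>"
  shows "Re (braket w (product_op \<sigma> \<tau> *v w))
    \<le> (\<Sum>z\<in>UNIV. Re (braket (\<chi> b. w $ join b z) (\<sigma> *v (\<chi> b. w $ join b z))))"
proof -
  \<comment> \<open>The block of \<open>w\<close> on which qubit 1 has the value
    \<open>b\<close>.\<close>
  define v where "v b = (\<chi> z. w $ join b z)" for b
  have "braket w (product_op \<sigma> \<tau> *v w)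
      = (\<Sum>a\<in>UNIV. \<Sum>z\<in>UNIV. \<Sum>b\<in>UNIV. \<Sum>y\<in>UNIV.
          cnj (w $ join a z) * (\<sigma> $ a $ b * \<tau> $ z $ y) * w $ join b y)"
    unfolding braket_matrix sum_join
    by (simp add: product_op_def join_first restrict_rest_join del: One_nat_def)
  also have "\<dots> = (\<Sum>a\<in>UNIV. \<Sum>b\<in>UNIV. \<Sum>z\<in>UNIV. \<Sum>y\<in>UNIV.
          cnj (w $ join a z) * (\<sigma> $ a $ b * \<tau> $ z $ y) * w $ join b y)"
    by (intro sum.cong refl, rule sum.swap)
  also have "\<dots> = (\<Sum>a\<in>UNIV. \<Sum>b\<in>UNIV. \<sigma> $ a $ b * braket (v a) (\<tau> *v v b))"
    by (simp add: braket_matrix v_def sum_distrib_left algebra_simps)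
  finally have 1: "braket w (product_op \<sigma> \<tau> *v w)
      = (\<Sum>a\<in>UNIV. \<Sum>b\<in>UNIV. \<sigma> $ a $ b * braket (v a) (\<tau> *v v b))" .
  have "(\<Sum>z\<in>UNIV. braket (\<chi> b. w $ join b z) (\<sigma> *v (\<chi> b. w $ join b z)))
      = (\<Sum>z\<in>UNIV. \<Sum>a\<in>UNIV. \<Sum>b\<in>UNIV. cnj (w $ join a z) * \<sigma> $ a $ b * w $ join b z)"
    by (simp add: braket_matrix)
  also have "\<dots> = (\<Sum>a\<in>UNIV. \<Sum>z\<in>UNIV. \<Sum>b\<in>UNIV. cnj (w $ join a z) * \<sigma> $ a $ b * w $ join b z)"
    by (rule sum.swap)
  also have "\<dots> = (\<Sum>a\<in>UNIV. \<Sum>b\<in>UNIV. \<Sum>z\<in>UNIV. cnj (w $ join a z) * \<sigma> $ a $ b * w $ join b z)"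
    by (intro sum.cong refl, rule sum.swap)
  also have "\<dots> = (\<Sum>a\<in>UNIV. \<Sum>b\<in>UNIV. \<sigma> $ a $ b * braket (v a) (v b))"
    by (simp add: braket_def v_def sum_distrib_left algebra_simps)
  finally have 2: "(\<Sum>z\<in>UNIV. braket (\<chi> b. w $ join b z) (\<sigma> *v (\<chi> b. w $ join b z)))
      = (\<Sum>a\<in>UNIV. \<Sum>b\<in>UNIV. \<sigma> $ a $ b * braket (v a) (v b))" .
  have "0 \<le> Re (\<Sum>a\<in>UNIV. \<Sum>b\<in>UNIV. \<sigma> $ a $ b * braket (v a) ((mat 1 - \<tau>) *v v b))"
    using assms
    by (intro tensor_bool_nonneg state_complement_positive_semidefinite) (auto simp: state_def)
  also have "\<dots> = Re ((\<Sum>a\<in>UNIV. \<Sum>b\<in>UNIV. \<sigma> $ a $ b * braket (v a) (v b))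
      - (\<Sum>a\<in>UNIV. \<Sum>b\<in>UNIV. \<sigma> $ a $ b * braket (v a) (\<tau> *v v b)))"
    by (simp only: matrix_vector_mult_diff_rdistrib matrix_vector_mul_lid braket_diff_right
        right_diff_distrib sum_subtractf)
  finally show ?thesis
    unfolding 1 2 [symmetric] by (simp flip: Re_sum)
qed

lemma linear_quadratic_form: "linear (\<lambda>M. Re (braket v (M *v v)))"
proof (rule linearI)
  fix M N :: "'a op" and r :: real
  show "Re (braket v ((M + N) *v v)) = Re (braket v (M *v v)) + Re (braket v (N *v v))"
    by (simp add: matrix_vector_mult_add_rdistrib braket_add_right)
  have "braket v ((r *\<^sub>R M) *v v) = of_real r * braket v (M *v v)"
    unfolding braket_matrix
    by (simp add: sum_distrib_left scaleR_conv_of_real[where ?'a=complex] algebra_simps)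
  then show "Re (braket v ((r *\<^sub>R M) *v v)) = r *\<^sub>R Re (braket v (M *v v))"
    by simp
qed

lemma linear_reduced_first: "linear reduced_first"
  by (rule linearI) (simp_all add: vec_eq_iff reduced_first_def sum.distrib scaleR_sum_right)

text \<open>In operator form: \<open>\<rho> \<le> \<rho>\<^sub>1 \<otimes> 1\<close> (the reduction criterion), which fails for entangled
  states.\<close>

lemma separable_reduction_criterion:
  assumes "separable_first \<rho>"
  shows "Re (braket w (\<rho> *v w))
    \<le> (\<Sum>z\<in>UNIV. Re (braket (\<chi> b. w $ join b z) (reduced_first \<rho> *v (\<chi> b. w $ join b z))))"
proof -
  let ?f = "\<lambda>\<rho>. Re (braket w (\<rho> *v w))
    - (\<Sum>z\<in>UNIV. Re (braket (\<chi> b. w $ join b z) (reduced_first \<rho> *v (\<chi> b. w $ join b z))))"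
  have "linear ?f"
    using linear_compose [OF linear_reduced_first linear_quadratic_form]
    by (intro linear_compose_sub linear_compose_sum linear_quadratic_form) (simp add: o_def)
  \<comment> \<open>The criterion describes a half-space, which contains the convex hull as soon as
    it contains the product states.\<close>
  then have "convex (?f -` {..0})"
    by (intro convex_linear_vimage) auto
  moreover have "{product_op \<sigma> \<tau> | \<sigma> \<tau>. state \<sigma> \<and> state \<tau>} \<subseteq> ?f -` {..0}"
    using product_reduction_criterion by (auto simp: reduced_first_product state_def)
  ultimately have "\<rho> \<in> ?f -` {..0}"
    using assms hull_minimal unfolding separable_first_def by blast
  then show ?thesis by simp
qed

subsection \<open>Energies and passive energies\<close>

lemma hamiltonian_nth:
  "hamiltonian E \<alpha> $ x $ y =
    (if x = y then of_real (\<Sum>l\<in>UNIV. E l + of_bool (x l) * \<alpha> l) else 0)"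
proof (cases "x = y")
  case True
  then show ?thesis
    by (simp add: hamiltonian_def on_qubit_def qubit_hamiltonian_def)
next
  case False
  then have "on_qubit l (qubit_hamiltonian (E l) (\<alpha> l)) $ x $ y = 0" for l
    by (auto simp: on_qubit_def qubit_hamiltonian_def fun_eq_iff)
  then show ?thesis
    using False by (simp add: hamiltonian_def)
qed

lemma energy_diagonal:
  assumes "\<And>x y. K $ x $ y = (if x = y then of_real (h x) else 0)"
  shows "energy \<sigma> K = (\<Sum>x\<in>UNIV. Re (\<sigma> $ x $ x) * h x)"
proof -
  have "(\<Sum>j\<in>UNIV. \<sigma> $ i $ j * K $ j $ i) = \<sigma> $ i $ i * of_real (h i)" for i
    unfolding assms by (simp add: if_distrib cong: if_cong)
  then show ?thesis
    by (simp add: energy_def trace_def matrix_matrix_mult_def)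
qed

lemma energy_hamiltonian:
  "energy \<sigma> (hamiltonian E \<alpha>) =
    (\<Sum>x\<in>UNIV. Re (\<sigma> $ x $ x) * (\<Sum>l\<in>UNIV. E l + of_bool (x l) * \<alpha> l))"
  by (rule energy_diagonal) (rule hamiltonian_nth)

lemma energy_qubit_hamiltonian:
  assumes "trace \<sigma> = 1"
  shows "energy \<sigma> (qubit_hamiltonian e a) = e + a * (1 - Re (\<sigma> $ False $ False))"
proof -
  have "energy \<sigma> (qubit_hamiltonian e a) = (\<Sum>x\<in>UNIV. Re (\<sigma> $ x $ x) * (e + of_bool x * a))"
    by (rule energy_diagonal) (simp add: qubit_hamiltonian_def)
  moreover have "Re (\<sigma> $ True $ True) = 1 - Re (\<sigma> $ False $ False)"
    using arg_cong [OF assms, of Re] by (simp add: trace_def UNIV_bool)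
  ultimately show ?thesis
    by (simp add: UNIV_bool) (simp add: algebra_simps)
qed

lemma sum_qubit: "(\<Sum>l\<in>UNIV. f (label l)) = (\<Sum>l=1..10. f l)"
  by (rule sum.reindex_bij_witness [where i = qubit and j = label])
    (use label in \<open>auto simp: label_inverse qubit_inverse\<close>)

lemma sum_rest_qubit: "(\<Sum>k\<in>UNIV. f (rest_label k)) = (\<Sum>l=2..10. f l)"
  by (rule sum.reindex_bij_witness [where i = rest_qubit and j = rest_label])
    (use rest_label in \<open>auto simp: rest_label_inverse rest_qubit_inverse\<close>)

lemma sum_qubit_split:
  "(\<Sum>l\<in>UNIV. f (label l) (x l)) = f 1 (x first) + (\<Sum>k\<in>UNIV. f (rest_label k) (restrict_rest x k))"
proof -
  have "(\<Sum>l\<in>UNIV. f (label l) (x l)) = (\<Sum>l=1..10. f l (x (qubit l)))"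
    using sum_qubit [of "\<lambda>l. f l (x (qubit l))"] by (simp add: label_inverse)
  also have "\<dots> = f 1 (x first) + (\<Sum>l=2..10. f l (x (qubit l)))"
    by (subst sum.atLeast_Suc_atMost) (auto simp: numeral_2_eq_2)
  also have "(\<Sum>l=2..10. f l (x (qubit l))) = (\<Sum>k\<in>UNIV. f (rest_label k) (restrict_rest x k))"
    using sum_rest_qubit [of "\<lambda>l. f l (x (qubit l))"] by (simp add: restrict_rest_def)
  finally show ?thesis .
qed

text \<open>This cancels the energy of \<rho> in \<Delta> against those of its reductions, leaving
  only passive energies and ground-state energies.\<close>

lemma energy_split:
  "energy \<rho> (total_hamiltonian E \<alpha>) =
    energy (reduced_first \<rho>) (qubit_hamiltonian (E 1) (\<alpha> 1))
    + energy (reduced_rest \<rho>) (rest_hamiltonian E \<alpha>)"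
proof -
  define h where "h z = (\<Sum>k\<in>UNIV. E (rest_label k) + of_bool (z k) * \<alpha> (rest_label k))" for z
  have "energy \<rho> (total_hamiltonian E \<alpha>)
      = (\<Sum>x\<in>UNIV. Re (\<rho> $ x $ x) * (E 1 + of_bool (x first) * \<alpha> 1 + h (restrict_rest x)))"
    using sum_qubit_split [of "\<lambda>l b. E l + of_bool b * \<alpha> l"]
    by (simp add: total_hamiltonian_def energy_hamiltonian h_def)
  also have "\<dots> = (\<Sum>b\<in>UNIV. \<Sum>z\<in>UNIV. Re (\<rho> $ join b z $ join b z) * (E 1 + of_bool b * \<alpha> 1))
      + (\<Sum>b\<in>UNIV. \<Sum>z\<in>UNIV. Re (\<rho> $ join b z $ join b z) * h z)"
    by (simp only: sum_join join_first restrict_rest_join distrib_left sum.distrib)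
  also have "(\<Sum>b\<in>UNIV. \<Sum>z\<in>UNIV. Re (\<rho> $ join b z $ join b z) * (E 1 + of_bool b * \<alpha> 1))
      = (\<Sum>b\<in>UNIV. Re (reduced_first \<rho> $ b $ b) * (E 1 + of_bool b * \<alpha> 1))"
    by (simp add: reduced_first_def sum_distrib_right)
  also have "\<dots> = energy (reduced_first \<rho>) (qubit_hamiltonian (E 1) (\<alpha> 1))"
    by (rule energy_diagonal [symmetric]) (simp add: qubit_hamiltonian_def)
  also have "(\<Sum>b\<in>UNIV. \<Sum>z\<in>UNIV. Re (\<rho> $ join b z $ join b z) * h z)
      = (\<Sum>z\<in>UNIV. \<Sum>b\<in>UNIV. Re (\<rho> $ join b z $ join b z) * h z)"
    by (rule sum.swap)
  also have "\<dots> = (\<Sum>z\<in>UNIV. Re (reduced_rest \<rho> $ z $ z) * h z)"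
    by (simp add: reduced_rest_def sum_distrib_right)
  also have "\<dots> = energy (reduced_rest \<rho>) (rest_hamiltonian E \<alpha>)"
    by (simp add: rest_hamiltonian_def energy_hamiltonian h_def)
  finally show ?thesis .
qed

section \<open>Optimal unitaries and the largest eigenvalue of a qubit state\<close>

lemma ergotropy_attained:
  obtains U where "unitary U" "ergotropy \<sigma> K = energy \<sigma> K - energy (U ** \<sigma> ** dagger U) K"
    "\<And>V. unitary V \<Longrightarrow> energy (U ** \<sigma> ** dagger U) K \<le> energy (V ** \<sigma> ** dagger V) K"
proof -
  obtain U where U: "unitary U"
    "\<forall>V. unitary V \<longrightarrow> energy (U ** \<sigma> ** dagger U) K \<le> energy (V ** \<sigma> ** dagger V) K"
    using ergotropy_minimum_attained by blast
  have "(LEAST e. \<exists>U. unitary U \<and> e = energy (U ** \<sigma> ** dagger U) K)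
      = energy (U ** \<sigma> ** dagger U) K"
    using U by (intro Least_equality) auto
  then show ?thesis
    using U that by (auto simp: ergotropy_def)
qed

text \<open>Populations after a rotation are values of the quadratic form of \<rho> at the
  conjugated rows of \<open>U\<close>, so bounds on the form become bounds on populations.\<close>

lemma unitary_conjugation_diagonal:
  "(U ** \<rho> ** dagger U) $ x $ x
    = braket (\<chi> i. cnj (U $ x $ i)) (\<rho> *v (\<chi> i. cnj (U $ x $ i)))"
  unfolding braket_matrix matrix_matrix_mult_def
  by (simp add: dagger_nth sum_distrib_right) (rule sum.swap)

lemma unitary_row_norm:
  assumes "unitary U"
  shows "(\<Sum>i\<in>UNIV. (norm (U $ x $ i))\<^sup>2) = 1"
proof -
  have "(U ** dagger U) $ x $ x = 1"
    using assms by (simp add: unitary_def mat_def)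
  moreover have "(U ** dagger U) $ x $ x = of_real (\<Sum>k\<in>UNIV. (norm (U $ x $ k))\<^sup>2)"
    by (simp add: matrix_matrix_mult_def dagger_def complex_norm_square del: of_real_power)
  ultimately show ?thesis
    by (metis of_real_eq_1_iff)
qed

lemma trace_unitary_conjugation:
  fixes U :: "'n::finite op"
  assumes "unitary U"
  shows "trace (U ** \<rho> ** dagger U) = trace \<rho>"
proof -
  have "trace (U ** \<rho> ** dagger U) = trace (dagger U ** (U ** \<rho>))"
    by (rule trace_mul_sym)
  then show ?thesis
    using assms by (simp add: matrix_mul_assoc unitary_def)
qed

text \<open>In dimension two a unit vector has an explicit orthogonal complement, which supplies the
  other row.\<close>

lemma qubit_unitary_with_row:
  assumes "(\<Sum>b\<in>UNIV. (norm (v $ b))\<^sup>2) = 1"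
  obtains V :: "bool op" where "unitary V" "\<And>b. cnj (V $ False $ b) = v $ b"
proof
  let ?V = "\<chi> a b. if a then (if b then v $ False else - (v $ True)) else cnj (v $ b)"
  have "v $ True * cnj (v $ True) + v $ False * cnj (v $ False)
      = of_real (\<Sum>b\<in>UNIV. (norm (v $ b))\<^sup>2)"
    by (simp add: UNIV_bool complex_norm_square del: of_real_power)
  then have "v $ True * cnj (v $ True) + v $ False * cnj (v $ False) = 1"
    by (simp only: assms of_real_1)
  then show "unitary ?V"
    unfolding unitary_def vec_eq_iff
    by (simp add: matrix_matrix_mult_def dagger_def mat_def UNIV_bool all_bool_eq algebra_simps)
qed simp

text \<open>The number \<open>\<mu>\<close> is the largest eigenvalue of \<open>\<sigma>\<close>.\<close>

lemma qubit_largest_eigenvalue: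
  fixes \<sigma> :: "bool op"
  assumes "trace \<sigma> = 1"
  obtains U \<mu> where "unitary U" "Re ((U ** \<sigma> ** dagger U) $ False $ False) = \<mu>"
    "\<And>v. Re (braket v (\<sigma> *v v)) \<le> \<mu> * (\<Sum>b\<in>UNIV. (norm (v $ b))\<^sup>2)"
proof -
  \<comment> \<open>With ground energy 0 and gap 1 the energy is one minus the ground population. A
    minimiser thus maximises the quadratic form of \<sigma> over unit vectors, and its existence
    comes from compactness of the unitary group.\<close>
  obtain U where U: "unitary U" and min: "\<And>V. unitary V \<Longrightarrow>
      energy (U ** \<sigma> ** dagger U) (qubit_hamiltonian 0 1)
      \<le> energy (V ** \<sigma> ** dagger V) (qubit_hamiltonian 0 1)"
    using ergotropy_attained by blast
  define \<mu> where "\<mu> = Re ((U ** \<sigma> ** dagger U) $ False $ False)"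
  have unit: "Re (braket v (\<sigma> *v v)) \<le> \<mu>" if v: "(\<Sum>b\<in>UNIV. (norm (v $ b))\<^sup>2) = 1" for v
  proof -
    obtain V where V: "unitary V" "\<And>b. cnj (V $ False $ b) = v $ b"
      using qubit_unitary_with_row [OF v] by blast
    have "Re ((V ** \<sigma> ** dagger V) $ False $ False) \<le> \<mu>"
      using min [OF V(1)] U V(1) assms
      by (simp add: energy_qubit_hamiltonian trace_unitary_conjugation \<mu>_def)
    then show ?thesis
      by (simp add: unitary_conjugation_diagonal V(2) vec_nth_inverse)
  qed
  have "Re (braket v (\<sigma> *v v)) \<le> \<mu> * (\<Sum>b\<in>UNIV. (norm (v $ b))\<^sup>2)" for v
  proof (cases "v = 0")
    case True
    then show ?thesis by (simp add: braket_def)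
  next
    case False
    \<comment> \<open>Both sides are homogeneous of degree two in \<open>v\<close>, so it suffices
      to normalise.\<close>
    define r where "r = sqrt (\<Sum>b\<in>UNIV. (norm (v $ b))\<^sup>2)"
    have r: "r\<^sup>2 = (\<Sum>b\<in>UNIV. (norm (v $ b))\<^sup>2)"
      by (simp add: r_def sum_nonneg)
    have "r > 0"
      using False by (simp add: r_def norm_vec_def [of v, symmetric] flip: L2_set_def)
    define u where "u = of_real (1 / r) *s v"
    have "(\<Sum>b\<in>UNIV. (norm (u $ b))\<^sup>2) = (\<Sum>b\<in>UNIV. (norm (v $ b))\<^sup>2) / r\<^sup>2"
      using \<open>r > 0\<close> by (simp add: u_def norm_divide power_divide flip: sum_divide_distrib)
    then have "Re (braket u (\<sigma> *v u)) \<le> \<mu>"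
      using \<open>r > 0\<close> by (intro unit) (simp add: r [symmetric])
    moreover have "v = of_real r *s u"
      using \<open>r > 0\<close> by (simp add: u_def vec_eq_iff)
    then have "braket v (\<sigma> *v v) = of_real (r\<^sup>2) * braket u (\<sigma> *v u)"
      by (simp add: vector_scalar_commute braket_simps power2_eq_square)
    ultimately show ?thesis
      using \<open>r > 0\<close> by (simp add: mult.commute flip: r del: of_real_power)
  qed
  then show ?thesis
    using U that \<mu>_def by blast
qed

section \<open>Reduction to a capped probability distribution and the final estimates\<close>

lemma excitation_energy_ge:
  assumes "\<And>k. (0::real) \<le> g k" and "x l"
  shows "g l \<le> (\<Sum>k\<in>(UNIV::'q::finite set). of_bool (x k) * g k)"
  using assms member_le_sum [of l UNIV "\<lambda>k. of_bool (x k) * g k"] by simp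

text \<open>Here \<open>d\<close> lists the populations of \<rho> after an optimal rotation and
  \<mu> is the largest eigenvalue of the reduced state of qubit 1. What remains afterwards is an
  inequality for a probability distribution with entries at most \<mu>.\<close>

lemma Delta_first_le:
  assumes \<rho>: "state \<rho>" "separable_first \<rho>" and "0 \<le> gap 1"
  obtains d :: "(qubit \<Rightarrow> bool) \<Rightarrow> real" and \<mu> :: real
  where "\<And>x. 0 \<le> d x" "\<And>x. d x \<le> \<mu>" "(\<Sum>x\<in>UNIV. d x) = 1"
    "Delta_first E gap \<rho> \<le> gap 1 * (1 - \<mu>)
       - (\<Sum>x\<in>UNIV. d x * (\<Sum>l\<in>UNIV. of_bool (x l) * gap (label l)))"
proof -
  let ?\<rho>1 = "reduced_first \<rho>" and ?H1 = "qubit_hamiltonian (E 1) (gap 1)"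
    and ?H = "total_hamiltonian E gap"
  have tr: "trace \<rho> = 1" and pos: "\<And>v. 0 \<le> Re (braket v (\<rho> *v v))"
    using \<rho> by (auto simp: state_def positive_semidefinite_def)
  then have tr1: "trace ?\<rho>1 = 1"
    by (simp add: trace_reduced_first)
  obtain U1 \<mu> where U1: "unitary U1" "Re ((U1 ** ?\<rho>1 ** dagger U1) $ False $ False) = \<mu>"
    and \<mu>: "\<And>v. Re (braket v (?\<rho>1 *v v)) \<le> \<mu> * (\<Sum>b\<in>UNIV. (norm (v $ b))\<^sup>2)"
    using qubit_largest_eigenvalue [OF tr1] by metis
  \<comment> \<open>\<open>V\<close> is optimal and \<open>U1\<close> is a trial unitary; only a
    lower bound on the ergotropy of qubit 1 is needed, as it enters \<Delta> with a minus
    sign.\<close>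
  obtain V where "ergotropy ?\<rho>1 ?H1 = energy ?\<rho>1 ?H1 - energy (V ** ?\<rho>1 ** dagger V) ?H1"
    "energy (V ** ?\<rho>1 ** dagger V) ?H1 \<le> energy (U1 ** ?\<rho>1 ** dagger U1) ?H1"
    using ergotropy_attained U1(1) by metis
  moreover have "energy (U1 ** ?\<rho>1 ** dagger U1) ?H1 = E 1 + gap 1 * (1 - \<mu>)"
    using U1 tr1 by (simp add: energy_qubit_hamiltonian trace_unitary_conjugation)
  ultimately have W1: "energy ?\<rho>1 ?H1 - (E 1 + gap 1 * (1 - \<mu>)) \<le> ergotropy ?\<rho>1 ?H1"
    by simp
  obtain U where U: "unitary U" "ergotropy \<rho> ?H = energy \<rho> ?H - energy (U ** \<rho> ** dagger U) ?H"
    using ergotropy_attained by metis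
  define d where "d x = Re ((U ** \<rho> ** dagger U) $ x $ x)" for x
  have d_pos: "0 \<le> d x" for x
    using pos by (simp add: d_def unitary_conjugation_diagonal)
  have d_le: "d x \<le> \<mu>" for x
  proof -
    define w where "w = (\<chi> i. cnj (U $ x $ i))"
    \<comment> \<open>The reduction criterion splits \<open>w\<close> into blocks for qubit 1; the
      eigenvalue bound applies to each, and the squared norms of the blocks add up to 1.\<close>
    have "d x \<le> (\<Sum>z\<in>UNIV. Re (braket (\<chi> b. w $ join b z) (?\<rho>1 *v (\<chi> b. w $ join b z))))"
      unfolding d_def unitary_conjugation_diagonal w_def
      by (rule separable_reduction_criterion [OF \<rho>(2)])
    also have "\<dots> \<le> (\<Sum>z\<in>UNIV. \<mu> * (\<Sum>b\<in>UNIV. (norm ((\<chi> b. w $ join b z) $ b))\<^sup>2))"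
      by (intro sum_mono \<mu>)
    also have "\<dots> = \<mu> * (\<Sum>z\<in>UNIV. \<Sum>b\<in>UNIV. (norm (w $ join b z))\<^sup>2)"
      by (simp add: sum_distrib_left)
    also have "(\<Sum>z\<in>UNIV. \<Sum>b\<in>UNIV. (norm (w $ join b z))\<^sup>2) = (\<Sum>i\<in>UNIV. (norm (w $ i))\<^sup>2)"
      unfolding sum_join by (rule sum.swap)
    also have "\<dots> = 1"
      using unitary_row_norm [OF U(1)] by (simp add: w_def)
    finally show ?thesis by simp
  qed
  have d_sum: "(\<Sum>x\<in>UNIV. d x) = 1"
    using trace_unitary_conjugation [OF U(1), of \<rho>] tr
    unfolding d_def trace_def by (simp flip: Re_sum)
  have "energy (U ** \<rho> ** dagger U) ?H
      = (\<Sum>x\<in>UNIV. d x * ((\<Sum>l=1..10. E l) + (\<Sum>l\<in>UNIV. of_bool (x l) * gap (label l))))"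
    by (simp add: total_hamiltonian_def energy_hamiltonian d_def sum.distrib sum_qubit)
  also have "\<dots> = (\<Sum>l=1..10. E l)
      + (\<Sum>x\<in>UNIV. d x * (\<Sum>l\<in>UNIV. of_bool (x l) * gap (label l)))"
    using d_sum by (simp add: distrib_left sum.distrib flip: sum_distrib_right)
  also have "(\<Sum>l=1..10. E l) = E 1 + (\<Sum>l=2..10. E l)"
    by (subst sum.atLeast_Suc_atMost) (auto simp: numeral_2_eq_2)
  finally have "Delta_first E gap \<rho> \<le> gap 1 * (1 - \<mu>)
      - (\<Sum>x\<in>UNIV. d x * (\<Sum>l\<in>UNIV. of_bool (x l) * gap (label l)))"
    using W1 U(2) energy_split [of \<rho> E gap] by (simp add: Delta_first_def)
  then show ?thesis
    using that d_pos d_le d_sum by blast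
qed

theorem proposition4:
  fixes E gap :: "nat \<Rightarrow> real" and \<alpha> \<alpha>\<^sub>c :: real and c :: nat
    and \<rho> :: "(qubit \<Rightarrow> bool) op"
  assumes "c \<in> {1..10}"
    and "gap c = \<alpha>\<^sub>c"
    and "\<And>l. l \<in> {1..10} \<Longrightarrow> l \<noteq> c \<Longrightarrow> gap l = \<alpha>"
    and "\<alpha> > \<alpha>\<^sub>c" and "\<alpha>\<^sub>c \<ge> 0"
    and "state \<rho>" and "separable_first \<rho>"
  shows "(c = 1 \<longrightarrow> Delta_first E gap \<rho> \<le> 0) \<and>
         (gap 1 = \<alpha> \<longrightarrow> Delta_first E gap \<rho> \<le> (\<alpha> - \<alpha>\<^sub>c) / 2)"
proof -
  have gap_ge: "\<alpha>\<^sub>c \<le> gap (label l)" for l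
    using assms(2-4) label [of l] by (cases "label l = c") auto
  have gap_nonneg: "0 \<le> gap (label l)" for l
    using gap_ge assms(5) order_trans by blast
  have "label first = 1"
    by (rule qubit_inverse) auto
  then have "0 \<le> gap 1"
    using gap_nonneg [of first] by simp
  then obtain d \<mu> where d_pos: "\<And>x. 0 \<le> d x" and d_le: "\<And>x. d x \<le> \<mu>"
    and d_sum: "(\<Sum>x\<in>UNIV. d x) = 1"
    and \<Delta>: "Delta_first E gap \<rho> \<le> gap 1 * (1 - \<mu>)
       - (\<Sum>x\<in>UNIV. d x * (\<Sum>l\<in>UNIV. of_bool (x l) * gap (label l)))"
    by (rule Delta_first_le [OF assms(6,7), where E = E]) (rule that)
  \<comment> \<open>Excitation energy above the ground level; \<open>g\<close> below is the basis
    state with no excited qubit.\<close>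
  define h where "h x = (\<Sum>l\<in>UNIV. of_bool (x l) * gap (label l))" for x :: "qubit \<Rightarrow> bool"
  have h_ge: "gap (label l) \<le> h x" if "x l" for x l
    unfolding h_def using that gap_nonneg by (rule excitation_energy_ge [rotated])
  have h_nonneg: "0 \<le> h x" for x
    unfolding h_def using gap_nonneg by (intro sum_nonneg) auto
  define g where "g = (\<lambda>_::qubit. False)"
  have sum_d: "(\<Sum>x\<in>UNIV. d x * a) = a" for a
    using d_sum by (simp flip: sum_distrib_right)
  have sum_d_at: "(\<Sum>x\<in>UNIV. d x * (of_bool (x = y) * a)) = d y * a" for y a
  proof -
    have "(\<Sum>x\<in>UNIV. d x * (of_bool (x = y) * a)) = (\<Sum>x\<in>UNIV. if x = y then d x * a else 0)"
      by (intro sum.cong) auto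
    then show ?thesis by simp
  qed
  show ?thesis
  proof (intro conjI impI)
    assume "c = 1"
    \<comment> \<open>Averaging this pointwise bound over \<open>d\<close> gives at least
      \<open>\<alpha>\<^sub>c * (1 - d g)\<close>, to be compared with
      \<open>\<alpha>\<^sub>c * (1 - \<mu>)\<close>.\<close>
    have h: "\<alpha>\<^sub>c - of_bool (x = g) * \<alpha>\<^sub>c \<le> h x" for x
    proof (cases "x = g")
      case False
      then obtain l where "x l" by (auto simp: g_def fun_eq_iff)
      then show ?thesis using h_ge [of x l] gap_ge [of l] False by simp
    qed (simp add: h_nonneg)
    have "\<alpha>\<^sub>c - d g * \<alpha>\<^sub>c = (\<Sum>x\<in>UNIV. d x * (\<alpha>\<^sub>c - of_bool (x = g) * \<alpha>\<^sub>c))"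
      by (simp only: right_diff_distrib sum_subtractf sum_d sum_d_at)
    also have "\<dots> \<le> (\<Sum>x\<in>UNIV. d x * h x)"
      by (intro sum_mono mult_left_mono d_pos h)
    finally have "\<alpha>\<^sub>c - d g * \<alpha>\<^sub>c \<le> (\<Sum>x\<in>UNIV. d x * h x)" .
    moreover have "d g * \<alpha>\<^sub>c \<le> \<mu> * \<alpha>\<^sub>c"
      using assms(5) d_le [of g] by (intro mult_right_mono)
    ultimately show "Delta_first E gap \<rho> \<le> 0"
      using \<Delta> assms(2) \<open>c = 1\<close> by (simp add: h_def algebra_simps)
  next
    assume "gap 1 = \<alpha>"
    \<comment> \<open>Only the central qubit is excited: apart from \<open>g\<close>, the one basis
      state that may cost less than \<alpha>.\<close>
    define e where "e = (\<lambda>l. label l = c)"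
    have "label (qubit c) = c"
      using assms(1) by (rule qubit_inverse)
    then have "e \<noteq> g"
      by (auto simp: e_def g_def fun_eq_iff)
    have h: "\<alpha> - of_bool (x = g) * \<alpha> - of_bool (x = e) * (\<alpha> - \<alpha>\<^sub>c) \<le> h x" for x
    proof -
      consider "x = g" | "x = e" | l where "x l" "label l \<noteq> c" | "x \<noteq> g" "x \<noteq> e" "\<And>l. x l \<Longrightarrow> label l = c"
        by blast
      then show ?thesis
      proof cases
        case 1
        then show ?thesis using h_nonneg \<open>e \<noteq> g\<close> by auto
      next
        case 2
        then show ?thesis
          using h_ge [of e "qubit c"] \<open>e \<noteq> g\<close> \<open>label (qubit c) = c\<close> assms(2) by (simp add: e_def)
      next
        case 3
        then have "\<alpha> \<le> h x"
          using h_ge [of x l] assms(3) [of "label l"] label [of l] by simp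
        then show ?thesis using assms(4,5) by (auto simp: of_bool_def)
      next
        \<comment> \<open>This case is contradictory: a nonempty set of excited qubits containing
          only the central one is \<open>e\<close>.\<close>
        case 4
        then obtain l where "x l" by (auto simp: g_def fun_eq_iff)
        then have "x = e"
          using 4(3) unfolding e_def fun_eq_iff by (metis label_inject)
        then show ?thesis using 4 by simp
      qed
    qed
    have "\<alpha> - d g * \<alpha> - d e * (\<alpha> - \<alpha>\<^sub>c)
        = (\<Sum>x\<in>UNIV. d x * (\<alpha> - of_bool (x = g) * \<alpha> - of_bool (x = e) * (\<alpha> - \<alpha>\<^sub>c)))"
      by (simp only: right_diff_distrib [of "d _"] sum_subtractf sum_d sum_d_at)
    also have "\<dots> \<le> (\<Sum>x\<in>UNIV. d x * h x)"
      by (intro sum_mono mult_left_mono d_pos h)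
    finally have "Delta_first E gap \<rho> \<le> \<alpha> * (1 - \<mu>) - (\<alpha> - d g * \<alpha> - d e * (\<alpha> - \<alpha>\<^sub>c))"
      using \<Delta> \<open>gap 1 = \<alpha>\<close> by (simp add: h_def)
    \<comment> \<open>It remains to show that the subtracted bracket is nonnegative.\<close>
    also have "\<dots> = (\<alpha> - \<alpha>\<^sub>c) / 2 - (\<alpha> * (\<mu> - d g) + (1 / 2 - d e) * (\<alpha> - \<alpha>\<^sub>c))"
      by (simp add: field_simps)
    also have "\<dots> \<le> (\<alpha> - \<alpha>\<^sub>c) / 2"
    proof (cases "d e \<le> 1 / 2")
      case True
      then have "0 \<le> \<alpha> * (\<mu> - d g) + (1 / 2 - d e) * (\<alpha> - \<alpha>\<^sub>c)"
        using d_le [of g] assms(4,5) by (intro add_nonneg_nonneg mult_nonneg_nonneg) auto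
      then show ?thesis by linarith
    next
      case False
      \<comment> \<open>Since \<open>\<mu> \<ge> d e\<close> and \<open>d g \<le> 1 - d e\<close>,
        the gap \<open>\<mu> - d g\<close> is at least \<open>2 * d e - 1\<close>. The bracket is
        then at least \<open>(d e - 1 / 2) * (2 * \<alpha> - (\<alpha> - \<alpha>\<^sub>c))\<close>,
        which explains the factor \<open>\<alpha> + \<alpha>\<^sub>c\<close> below.\<close>
      have "d g + d e = (\<Sum>x\<in>{g, e}. d x)"
        using \<open>e \<noteq> g\<close> by simp
      also have "\<dots> \<le> 1"
        unfolding d_sum [symmetric] by (intro sum_mono2) (auto simp: d_pos)
      finally have "2 * d e - 1 \<le> \<mu> - d g"
        using d_le [of e] by simp
      then have "\<alpha> * (2 * d e - 1) \<le> \<alpha> * (\<mu> - d g)"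
        using assms(4,5) by (intro mult_left_mono) auto
      moreover have "0 \<le> (d e - 1 / 2) * (\<alpha> + \<alpha>\<^sub>c)"
        using False assms(4,5) by (intro mult_nonneg_nonneg) auto
      ultimately show ?thesis by (simp add: field_simps)
    qed
    finally show "Delta_first E gap \<rho> \<le> (\<alpha> - \<alpha>\<^sub>c) / 2" .
  qed
qed

end
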